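(* Let $(V,E)$ be a simple directed graph structure with $V=\{1,\dots,n\}$, let $d_i:=|\mathcal{N}(i)|$ for $i=1,\dots,n$, and let $A\in\mathbb{R}^{n\times n}$. The row-wise Sorting Algorithm (described in the context) solves the problem $$\min_{L\in\mathbb{R}^{n\times n}}\ \|A-L\|_{\mathrm F}^2\quad\text{subject to } L\in\mathcal{L}_{sd}(V,E)$$ with $O\left(\sum_{i=1}^n d_i\log d_i\right)$ time.
   Context: $E\subseteq V\times V$ is a set of directed edges; $\{i,j\}$ denotes the directed edge from $i$ to $j$; simple means that there are no self-loops ($\{i,i\}\notin E$ for all $i$) and no multiedges. $\mathcal{N}(i):=\{j\in V\mid \{i,j\}\in E,\ i\ne j\}$, with elements listed as $\mathcal{N}(i)_1,\dots,\mathcal{N}(i)_{d_i}$. $\mathcal{L}_{sd}(V,E)$ is the set of $L\in\mathbb{R}^{n\times n}$ with $L_{ii}\ge0$ for all $i$; $L_{ij}\le 0$ for $i\neq j$, $\{i,j\}\in E$; $L_{ij}=0$ for $i\ne j$, $\{i,j\}\notin E$; and $L\mathbf{1}_n=\mathbf{0}_n$, where $\mathbf{1}_n$ and $\mathbf{0}_n$ are the all-ones and zero vectors. $\|\cdot\|_{\mathrm F}$ is the Frobenius norm. $Q_m:=2\mathrm{I}_m+2\mathrm{J}_m$ with $\mathrm{I}_m$ the $m\times m$ identity and $\mathrm{J}_m$ the $m\times m$ all-ones matrix; $Q_m^{-1}=\frac12\left(\mathrm{I}_m-\frac1{1+m}\mathrm{J}_m\right)$, so that a product $Q_m^{-1}v$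 can be calculated in $O(m)$ time. For an index set $F$, $b_F$ is the subvector of $b$ with indices in $F$, and vectors in $\mathbb{R}^{|F|}$ are indexed by $F$. Sorting a vector of size $d$ takes $O(d\log d)$ time. Row-wise Sorting Algorithm (input: $A$ and the neighbor sets $\mathcal{N}(i)$, $i=1,\dots,n$): start with $L^\ast=\mathbf{0}_{n\times n}$. For each $i=1,\dots,n$: 1. Set $S:=0$, $F:=\emptyset$, $d:=|\mathcal{N}(i)|$, $x:=\mathbf{0}_d$, $b:=[2A_{ii}-2A_{i\mathcal{N}(i)_1},\dots,2A_{ii}-2A_{i\mathcal{N}(i)_d}]^\top$; by sorting, compute the order of indices $I=(I_1,\dots,I_d)$ (a permutation of $1,\dots,d$) with $b_{I_1}\ge b_{I_2}\ge\dots\ge b_{I_d}$. 2. For $j=1,\dots,d$: replace $S$ by $S+b_{I_j}$; if $b_{I_j}<S/(j+1)$, exit this inner loop; otherwise replace $F$ by $F\cup\{I_j\}$. 3. Set $x_F:=-Q_{|F|}^{-1}b_F$; set $L^\ast_{i\mathcal{N}(i)_q}:=x_q$ for $q=1,\dots,d$ and $L^\ast_{ii}:=-\mathbf{1}^\top x$. Output $L^\ast$.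
   Formalization: The time bound proved is O(Σ d_i log d_i + #{i : d_i ≤ 1}), since d log d = 0 for d ≤ 1 although each row costs at least one step (e.g. the empty graph); creating the initial zero matrix L* is not charged, as filling it densely would take n² steps. *)

theory Defs
  imports Complex_Main "HOL-Library.Monad_Syntax" "Jordan_Normal_Form.Matrix"
begin

section \<open>The optimization problem\<close>

text \<open>Vertices are the numbers below \<open>n\<close> (the matrices of the library are indexed from 0), and the
  directed edge from \<open>i\<close> to \<open>j\<close> is the pair \<open>(i, j)\<close>.\<close>

definition simple_digraph :: "nat \<Rightarrow> (nat \<times> nat) set \<Rightarrow> bool" where
  "simple_digraph n E \<longleftrightarrow> E \<subseteq> {..<n} \<times> {..<n} \<and> (\<forall>i. (i, i) \<notin> E)"

definition nbrs :: "nat \<Rightarrow> (nat \<times> nat) set \<Rightarrow> nat \<Rightarrow> nat set" where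
  "nbrs n E i = {j. j < n \<and> (i, j) \<in> E \<and> i \<noteq> j}"

definition L_sd :: "nat \<Rightarrow> (nat \<times> nat) set \<Rightarrow> real mat set" where
  "L_sd n E = {L \<in> carrier_mat n n.
     (\<forall>i<n. L $$ (i, i) \<ge> 0) \<and>
     (\<forall>i<n. \<forall>j<n. i \<noteq> j \<longrightarrow> (i, j) \<in> E \<longrightarrow> L $$ (i, j) \<le> 0) \<and>
     (\<forall>i<n. \<forall>j<n. i \<noteq> j \<longrightarrow> (i, j) \<notin> E \<longrightarrow> L $$ (i, j) = 0) \<and>
     L *\<^sub>v vec n (\<lambda>_. 1) = 0\<^sub>v n}"

definition frobenius_norm :: "real mat \<Rightarrow> real" where
  "frobenius_norm M = sqrt (\<Sum>i<dim_row M. \<Sum>j<dim_col M. (M $$ (i, j))\<^sup>2)"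


section \<open>Running time\<close>

text \<open>A computation is a result together with the number of elementary steps spent on it.  The
  model is a unit-cost real RAM: an arithmetic operation or comparison on reals or indices, reading
  or writing one array or matrix entry, adding one element to a list, and each pass through a loop
  cost one step.  Lists serve as arrays wherever they are accessed by position.\<close>

datatype 'a tm = TM (val: 'a) (steps: nat)

definition tm_return :: "'a \<Rightarrow> 'a tm" where
  "tm_return x = TM x 0"

definition tick :: "'a \<Rightarrow> 'a tm" where
  "tick x = TM x 1"

definition ticks :: "nat \<Rightarrow> 'a \<Rightarrow> 'a tm" where
  "ticks k x = TM x k"

definition tm_bind :: "'a tm \<Rightarrow> ('a \<Rightarrow> 'b tm) \<Rightarrow> 'b tm" where
  "tm_bind m f = TM (val (f (val m))) (steps m + steps (f (val m)))"

adhoc_overloading Monad_Syntax.bind \<rightleftharpoons> tm_bind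

primrec for_each :: "'a list \<Rightarrow> ('a \<Rightarrow> 's \<Rightarrow> 's tm) \<Rightarrow> 's \<Rightarrow> 's tm" where
  "for_each [] f s = tm_return s"
| "for_each (x # xs) f s = do { tick (); s' \<leftarrow> f x s; for_each xs f s' }"

primrec tm_map :: "('a \<Rightarrow> 'b tm) \<Rightarrow> 'a list \<Rightarrow> 'b list tm" where
  "tm_map f [] = tm_return []"
| "tm_map f (x # xs) = do { tick (); y \<leftarrow> f x; ys \<leftarrow> tm_map f xs; tick (y # ys) }"

definition tm_sum :: "real list \<Rightarrow> real tm" where
  "tm_sum v = for_each v (\<lambda>a s. tick (s + a)) 0"

lemma val_tm_simps [simp]:
  "val (tm_return x) = x" "val (tick x) = x" "val (ticks k x) = x"
  "val (tm_bind m f) = val (f (val m))"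
  by (simp_all add: tm_return_def tick_def ticks_def tm_bind_def)

lemma steps_tm_simps [simp]:
  "steps (tm_return x) = 0" "steps (tick x) = 1" "steps (ticks k x) = k"
  "steps (tm_bind m f) = steps m + steps (f (val m))"
  by (simp_all add: tm_return_def tick_def ticks_def tm_bind_def)

lemma tm_bind_cong [fundef_cong]:
  "m = m' \<Longrightarrow> (\<And>x. x = val m' \<Longrightarrow> f x = g x) \<Longrightarrow> tm_bind m f = tm_bind m' g"
  by (simp add: tm_bind_def)

lemma val_tm_map [simp]: "val (tm_map f xs) = map (\<lambda>x. val (f x)) xs"
  by (induction xs) auto

lemma tm_sum_simps [simp]: "val (tm_sum v) = sum_list v" "steps (tm_sum v) = 2 * length v"
proof -
  have "val (for_each v (\<lambda>a s. tick (s + a)) s) = s + sum_list v \<and>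
      steps (for_each v (\<lambda>a s. tick (s + a)) s) = 2 * length v" for s
    by (induction v arbitrary: s) auto
  then show "val (tm_sum v) = sum_list v" "steps (tm_sum v) = 2 * length v"
    by (simp_all add: tm_sum_def)
qed


section \<open>Multiplication with the inverse of \<open>Q\<close>\<close>

definition I_mat :: "nat \<Rightarrow> real mat" where
  "I_mat m = 1\<^sub>m m"

definition J_mat :: "nat \<Rightarrow> real mat" where
  "J_mat m = mat m m (\<lambda>_. 1)"

definition Q_mat :: "nat \<Rightarrow> real mat" where
  "Q_mat m = 2 \<cdot>\<^sub>m I_mat m + 2 \<cdot>\<^sub>m J_mat m"

definition Q_inv :: "nat \<Rightarrow> real mat" where
  "Q_inv m = (1/2) \<cdot>\<^sub>m (I_mat m - (1 / (1 + real m)) \<cdot>\<^sub>m J_mat m)"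

lemma Q_inv_inverse: "inverts_mat (Q_mat m) (Q_inv m)" "inverts_mat (Q_inv m) (Q_mat m)"
proof -
  define r where "r = 1 / (1 + real m)"
  have r: "r + real m * r = 1" by (simp add: r_def field_simps)
  have "Q_mat m * Q_inv m = 1\<^sub>m m"
  proof (rule eq_matI)
    fix i j assume "i < dim_row (1\<^sub>m m :: real mat)" "j < dim_col (1\<^sub>m m :: real mat)"
    then have ij: "i < m" "j < m" by auto
    have "(Q_mat m * Q_inv m) $$ (i, j) =
        (\<Sum>k<m. (2 * (if i = k then 1 else 0) + 2) * (1/2 * ((if k = j then 1 else 0) - r)))"
      using ij by (auto simp: Q_mat_def Q_inv_def I_mat_def J_mat_def r_def scalar_prod_def
          atLeast0LessThan intro!: sum.cong)
    also have "\<dots> = (\<Sum>k<m. (if i = k then (if k = j then 1 else 0) else 0)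
          + (if i = k then - r else 0) + (if k = j then 1 else 0)
          - r)"
      by (intro sum.cong) (auto simp: field_simps)
    also have "\<dots> = (if i = j then 1 else 0)"
      using ij r by (simp add: sum.distrib sum_subtractf)
    finally show "(Q_mat m * Q_inv m) $$ (i, j) = 1\<^sub>m m $$ (i, j)" using ij by simp
  qed (auto simp: Q_mat_def Q_inv_def I_mat_def J_mat_def)
  then show "inverts_mat (Q_mat m) (Q_inv m)"
    by (simp add: inverts_mat_def Q_mat_def I_mat_def J_mat_def)
  have "Q_inv m * Q_mat m = 1\<^sub>m m"
  proof (rule eq_matI)
    fix i j assume "i < dim_row (1\<^sub>m m :: real mat)" "j < dim_col (1\<^sub>m m :: real mat)"
    then have ij: "i < m" "j < m" by auto
    have "(Q_inv m * Q_mat m) $$ (i, j) =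
        (\<Sum>k<m. (1/2 * ((if i = k then 1 else 0) - r)) * (2 * (if k = j then 1 else 0) + 2))"
      using ij by (auto simp: Q_mat_def Q_inv_def I_mat_def J_mat_def r_def scalar_prod_def
          atLeast0LessThan intro!: sum.cong)
    also have "\<dots> = (\<Sum>k<m. (if i = k then (if k = j then 1 else 0) else 0)
          + (if k = j then - r else 0) + (if i = k then 1 else 0)
          - r)"
      by (intro sum.cong) (auto simp: field_simps)
    also have "\<dots> = (if i = j then 1 else 0)"
      using ij r by (simp add: sum.distrib sum_subtractf)
    finally show "(Q_inv m * Q_mat m) $$ (i, j) = 1\<^sub>m m $$ (i, j)" using ij by simp
  qed (auto simp: Q_mat_def Q_inv_def I_mat_def J_mat_def)
  then show "inverts_mat (Q_inv m) (Q_mat m)"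
    by (simp add: inverts_mat_def Q_inv_def I_mat_def J_mat_def)
qed

text \<open>Computes \<open>Q_inv m *\<^sub>v v\<close> with linearly many steps, where \<open>m\<close> is the length of \<open>v\<close>.\<close>

definition Q_inv_mult :: "real list \<Rightarrow> real list tm" where
  "Q_inv_mult v = do {
     s \<leftarrow> tm_sum v;
     m \<leftarrow> tick (length v);
     m' \<leftarrow> tick (1 + real m);
     r \<leftarrow> tick (s / m');
     tm_map (\<lambda>a. do { e \<leftarrow> tick (a - r); tick (1/2 * e) }) v
   }"

lemma Q_inv_mult_correct:
  "val (Q_inv_mult v) = list_of_vec (Q_inv (length v) *\<^sub>v vec_of_list v)"
proof (rule nth_equalityI)
  show "length (val (Q_inv_mult v)) = length (list_of_vec (Q_inv (length v) *\<^sub>v vec_of_list v))"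
    by (simp add: Q_inv_mult_def Q_inv_def I_mat_def J_mat_def)
next
  fix i assume "i < length (val (Q_inv_mult v))"
  then have i: "i < length v" by (simp add: Q_inv_mult_def)
  let ?r = "1 / (1 + real (length v))"
  have "list_of_vec (Q_inv (length v) *\<^sub>v vec_of_list v) ! i =
      (\<Sum>k<length v. (1/2 * ((if i = k then 1 else 0) - ?r)) * v ! k)"
    using i by (auto simp: Q_inv_def I_mat_def J_mat_def scalar_prod_def list_of_vec_index
        vec_of_list_index atLeast0LessThan intro!: sum.cong)
  also have "\<dots> = (\<Sum>k<length v. (if i = k then 1/2 * v ! k else 0) - 1/2 * ?r * v ! k)"
    by (intro sum.cong) (auto simp: algebra_simps)
  also have "\<dots> = 1/2 * v ! i - 1/2 * ?r * sum_list v"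
    using i by (simp add: sum_subtractf sum_list_sum_nth atLeast0LessThan sum_divide_distrib)
  also have "\<dots> = val (Q_inv_mult v) ! i"
    using i by (simp add: Q_inv_mult_def field_simps)
  finally show "val (Q_inv_mult v) ! i = list_of_vec (Q_inv (length v) *\<^sub>v vec_of_list v) ! i" ..
qed

lemma steps_Q_inv_mult: "steps (Q_inv_mult v) = 6 * length v + 3"
proof -
  have "steps (tm_map (\<lambda>a. do { e \<leftarrow> tick (a - r); tick (1/2 * e) }) v) = 4 * length v" for r :: real
    by (induction v) auto
  then show ?thesis by (simp add: Q_inv_mult_def)
qed


section \<open>Sorting\<close>

text \<open>\<open>I\<close> lists the positions of \<open>b\<close> in an order that makes \<open>b\<close> non-increasing.\<close>

definition sorting_order :: "real list \<Rightarrow> nat list \<Rightarrow> bool" where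
  "sorting_order b I \<longleftrightarrow>
     distinct I \<and> set I = {..<length b} \<and> sorted_wrt (\<ge>) (map (\<lambda>k. b ! k) I)"

text \<open>The algorithm is stated for an arbitrary sorting routine that needs \<open>O(d log d)\<close> steps; ties
  may be broken in any way.  The maximum only matters for \<open>d \<le> 1\<close>, where \<open>d log d\<close> vanishes.\<close>

definition sorting_routine :: "(real list \<Rightarrow> nat list tm) \<Rightarrow> bool" where
  "sorting_routine srt \<longleftrightarrow>
     (\<forall>b. sorting_order b (val (srt b))) \<and>
     (\<exists>c. \<forall>b. real (steps (srt b)) \<le> c * max 1 (real (length b) * log 2 (real (length b))))"

text \<open>Merge sort is such a routine.\<close>

fun merge_idx :: "real list \<Rightarrow> nat list \<Rightarrow> nat list \<Rightarrow> nat list tm" where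
  "merge_idx b [] ys = tm_return ys"
| "merge_idx b xs [] = tm_return xs"
| "merge_idx b (x # xs) (y # ys) = do {
     u \<leftarrow> tick (b ! x);
     v \<leftarrow> tick (b ! y);
     c \<leftarrow> tick (u \<ge> v);
     if c then do { zs \<leftarrow> merge_idx b xs (y # ys); tick (x # zs) }
     else do { zs \<leftarrow> merge_idx b (x # xs) ys; tick (y # zs) }
   }"

fun msort_idx :: "real list \<Rightarrow> nat list \<Rightarrow> nat list tm" where
  "msort_idx b xs = do {
     h \<leftarrow> tick (length xs div 2);
     c \<leftarrow> tick (h = 0);
     if c then tm_return xs
     else do {
       l \<leftarrow> ticks (length xs) (take h xs);
       r \<leftarrow> ticks (length xs) (drop h xs);
       l' \<leftarrow> msort_idx b l;
       r' \<leftarrow> msort_idx b r;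
       merge_idx b l' r'
     }
   }"

declare msort_idx.simps [simp del]

definition merge_sort :: "real list \<Rightarrow> nat list tm" where
  "merge_sort b = do { I \<leftarrow> ticks (length b) [0..<length b]; msort_idx b I }"

lemma merge_idx_set: "set (val (merge_idx b xs ys)) = set xs \<union> set ys"
  by (induction b xs ys rule: merge_idx.induct) auto

lemma merge_idx_length: "length (val (merge_idx b xs ys)) = length xs + length ys"
  by (induction b xs ys rule: merge_idx.induct) auto

lemma merge_idx_sorted:
  "sorted_wrt (\<ge>) (map ((!) b) xs) \<Longrightarrow> sorted_wrt (\<ge>) (map ((!) b) ys) \<Longrightarrow>
     sorted_wrt (\<ge>) (map ((!) b) (val (merge_idx b xs ys)))"
  by (induction b xs ys rule: merge_idx.induct) (fastforce simp: merge_idx_set)+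

lemma merge_idx_steps: "steps (merge_idx b xs ys) \<le> 4 * (length xs + length ys)"
  by (induction b xs ys rule: merge_idx.induct) auto

lemma msort_idx_correct:
  "set (val (msort_idx b xs)) = set xs \<and> length (val (msort_idx b xs)) = length xs \<and>
     sorted_wrt (\<ge>) (map ((!) b) (val (msort_idx b xs)))"
proof (induction "length xs" arbitrary: xs rule: less_induct)
  case less
  show ?case
  proof (cases "length xs div 2 = 0")
    case True
    then have "length xs \<le> 1" by linarith
    then have "xs = [] \<or> (\<exists>x. xs = [x])" by (cases xs) auto
    then show ?thesis by (auto simp: msort_idx.simps[of b xs])
  next
    case False
    let ?h = "length xs div 2"
    have *: "set (take ?h xs) \<union> set (drop ?h xs) = set xs"
      by (metis append_take_drop_id set_append)
    have "length (take ?h xs) < length xs" "length (drop ?h xs) < length xs"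
      using False by auto
    from less[OF this(1)] less[OF this(2)] show ?thesis using False *
      by (auto simp: msort_idx.simps[of b xs] merge_idx_set merge_idx_length
          intro!: merge_idx_sorted)
  qed
qed

lemma msort_idx_steps:
  "xs \<noteq> [] \<Longrightarrow> length xs \<le> 2 ^ l \<Longrightarrow> steps (msort_idx b xs) \<le> 8 * length xs * l + 2"
proof (induction l arbitrary: xs)
  case 0
  then have "length xs = 1" by (cases xs) auto
  then show ?case by (simp add: msort_idx.simps[of b xs])
next
  case (Suc l)
  show ?case
  proof (cases "length xs div 2 = 0")
    case True
    then show ?thesis by (simp add: msort_idx.simps[of b xs])
  next
    case False
    let ?h = "length xs div 2"
    let ?l = "take ?h xs" and ?r = "drop ?h xs"
    have le: "length ?l \<le> 2 ^ l" "length ?r \<le> 2 ^ l" and ne: "?l \<noteq> []" "?r \<noteq> []"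
      using Suc.prems False by auto
    have len: "length ?l + length ?r = length xs" by simp
    have "steps (merge_idx b (val (msort_idx b ?l)) (val (msort_idx b ?r))) \<le> 4 * length xs"
      using merge_idx_steps[of b "val (msort_idx b ?l)" "val (msort_idx b ?r)"] len
      by (simp add: msort_idx_correct)
    then have "steps (msort_idx b xs) \<le>
        2 + 2 * length xs + steps (msort_idx b ?l) + steps (msort_idx b ?r) + 4 * length xs"
      using False by (simp add: msort_idx.simps[of b xs])
    also have "\<dots> \<le> 2 + 6 * length xs + (8 * length ?l * l + 2) + (8 * length ?r * l + 2)"
      using Suc.IH[OF ne(1) le(1)] Suc.IH[OF ne(2) le(2)] by linarith
    also have "\<dots> = 6 + 6 * length xs + 8 * (length ?l + length ?r) * l"
      by (simp only: add_mult_distrib add_mult_distrib2)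
    also have "\<dots> \<le> 8 * length xs * Suc l + 2"
      unfolding len using False by (simp add: algebra_simps)
    finally show ?thesis .
  qed
qed

lemma sorting_routine_merge_sort: "sorting_routine merge_sort"
proof -
  have "sorting_order b (val (merge_sort b))" for b
  proof -
    have *: "set (val (merge_sort b)) = {..<length b}" "length (val (merge_sort b)) = length b"
      "sorted_wrt (\<ge>) (map ((!) b) (val (merge_sort b)))"
      using msort_idx_correct[of b "[0..<length b]"]
      by (auto simp: merge_sort_def)
    then show ?thesis by (simp add: sorting_order_def card_distinct)
  qed
  moreover have "real (steps (merge_sort b)) \<le>
      19 * max 1 (real (length b) * log 2 (real (length b)))" for b
  proof (cases "length b \<le> 1")
    case True
    then have "length [0..<length b] div 2 = 0" by simp
    then have "steps (merge_sort b) \<le> 3"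
      using True by (simp add: merge_sort_def msort_idx.simps)
    then show ?thesis by (simp add: max_def)
  next
    case False
    define d where "d = length b"
    define l where "l = nat \<lceil>log 2 (real d)\<rceil>"
    have d: "d \<ge> 2" using False by (simp add: d_def)
    have log1: "log 2 (real d) \<ge> 1" using d by (simp add: le_log_iff)
    have "log 2 (real d) \<le> real l" unfolding l_def by linarith
    then have "real d \<le> 2 powr real l" using d by (simp add: log_le_iff)
    then have "real d \<le> real (2 ^ l)" by (simp add: powr_realpow)
    then have dl: "d \<le> 2 ^ l" by linarith
    have l: "real l \<le> 2 * log 2 (real d)" using log1 unfolding l_def by linarith
    have "[0..<d] \<noteq> []" using d by simp
    then have "steps (msort_idx b [0..<d]) \<le> 8 * d * l + 2"
      using msort_idx_steps[of "[0..<d]" l b] dl by simp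
    then have "steps (merge_sort b) \<le> d + 8 * d * l + 2"
      by (simp add: merge_sort_def flip: d_def)
    then have "real (steps (merge_sort b)) \<le> real (d + 8 * d * l + 2)" by linarith
    also have "\<dots> = real d + 8 * real d * real l + 2" by simp
    also have "8 * real d * real l \<le> 8 * real d * (2 * log 2 (real d))"
      by (intro mult_left_mono l) simp
    also have "real d + 8 * real d * (2 * log 2 (real d)) + 2 \<le>
        2 * real d + 8 * real d * (2 * log 2 (real d))"
      using d by simp
    also have "\<dots> \<le> 18 * (real d * log 2 (real d))"
      using mult_left_mono[OF log1, of "real d"] by simp
    also have "\<dots> \<le> 19 * max 1 (real d * log 2 (real d))" by (simp add: max_def)
    finally show ?thesis by (simp add: d_def)
  qed
  ultimately show ?thesis unfolding sorting_routine_def by blast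
qed


section \<open>The row-wise sorting algorithm\<close>

text \<open>The inner loop of the second phase, run through the sorted indices; \<open>j\<close> counts from 1.  The
  set \<open>F\<close> is represented by the list of its elements.\<close>

primrec select :: "real list \<Rightarrow> nat list \<Rightarrow> nat \<Rightarrow> real \<Rightarrow> nat list \<Rightarrow> nat list tm" where
  "select b [] j S F = tm_return F"
| "select b (k # I) j S F = do {
     a \<leftarrow> tick (b ! k);
     S' \<leftarrow> tick (S + a);
     j' \<leftarrow> tick (j + 1);
     t \<leftarrow> tick (S' / real j');
     c \<leftarrow> tick (a < t);
     if c then tm_return F
     else do { F' \<leftarrow> tick (k # F); select b I j' S' F' }
   }"

text \<open>The vector \<open>x\<close> for one row; \<open>ns\<close> lists the neighbors of \<open>i\<close>.  The vector \<open>b\<^sub>F\<close> and the product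
  with it are stored in the order of the list \<open>F\<close>, which is harmless since \<open>Q_inv\<close> is invariant
  under simultaneous permutation of rows and columns.\<close>

definition row_solve :: "(real list \<Rightarrow> nat list tm) \<Rightarrow> real mat \<Rightarrow> nat \<Rightarrow> nat list \<Rightarrow> real list tm" where
  "row_solve srt A i ns = do {
     d \<leftarrow> tick (length ns);
     x \<leftarrow> ticks d (replicate d 0);
     b \<leftarrow> tm_map (\<lambda>k. do {
            a \<leftarrow> tick (A $$ (i, i));
            a' \<leftarrow> tick (A $$ (i, k));
            p \<leftarrow> tick (2 * a);
            p' \<leftarrow> tick (2 * a');
            tick (p - p') }) ns;
     I \<leftarrow> srt b;
     F \<leftarrow> select b I 1 0 [];
     bF \<leftarrow> tm_map (\<lambda>k. tick (b ! k)) F;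
     y \<leftarrow> Q_inv_mult bF;
     for_each (zip F y) (\<lambda>(k, a) x. do { z \<leftarrow> tick (- a); tick (x[k := z]) }) x
   }"

definition row_step ::
  "(real list \<Rightarrow> nat list tm) \<Rightarrow> real mat \<Rightarrow> nat \<Rightarrow> nat list \<Rightarrow> real mat \<Rightarrow> real mat tm" where
  "row_step srt A i ns L = do {
     x \<leftarrow> row_solve srt A i ns;
     L' \<leftarrow> for_each (zip ns x) (\<lambda>(k, a) M. tick (M |\<^sub>m (i, k) \<mapsto> a)) L;
     s \<leftarrow> tm_sum x;
     s' \<leftarrow> tick (- s);
     tick (L' |\<^sub>m (i, i) \<mapsto> s')
   }"

text \<open>The zero matrix the algorithm starts from is not charged: only entries in positions \<open>(i, i)\<close>
  and \<open>(i, j)\<close> with \<open>j\<close> a neighbor of \<open>i\<close> are ever written (a sparse matrix), whereas filling a dense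
  array would alone take \<open>n\<^sup>2\<close> steps.\<close>

definition rowwise_sorting ::
  "(real list \<Rightarrow> nat list tm) \<Rightarrow> nat \<Rightarrow> real mat \<Rightarrow> (nat \<Rightarrow> nat list) \<Rightarrow> real mat tm" where
  "rowwise_sorting srt n A N =
     for_each [0..<n] (\<lambda>i L. do { ns \<leftarrow> tick (N i); row_step srt A i ns L }) (0\<^sub>m n n)"

end

(* Fix a row i and put t = L (i, i).  If L (i, j) = - max 0 (A (i, i) - A (i, j) - t) for every
   neighbor j, and the row sums to 0, then the row satisfies the KKT conditions of its convex
   quadratic subproblem and is optimal.  The sorting phase finds this threshold: when F collects the
   m largest entries of b, the value r = (sum of b over F) / (m + 1) separates F from the remaining
   indices, and x_k = - max 0 (b_k - r) / 2 sums to - r / 2, so t = r / 2. *)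
theory Submission
  imports Defs
begin

section \<open>Loops\<close>

lemma val_for_each: "val (for_each xs f s) = fold (\<lambda>x s. val (f x s)) xs s"
  by (induction xs arbitrary: s) auto

lemma steps_for_each_const:
  assumes "\<And>x s. steps (f x s) = c"
  shows "steps (for_each xs f s) = (c + 1) * length xs"
  using assms by (induction xs arbitrary: s) auto

text \<open>The cost of a pass may depend on the element, because the outer loop spends a different
  amount on each row; the summand 1 pays for the pass itself.\<close>

lemma steps_for_each_le:
  assumes "\<And>x s. x \<in> set xs \<Longrightarrow> real (steps (f x s)) \<le> c x"
  shows "real (steps (for_each xs f s)) \<le> (\<Sum>x\<leftarrow>xs. c x + 1)"
  using assms
proof (induction xs arbitrary: s)
  case (Cons x xs)
  have "real (steps (f x s)) \<le> c x" using Cons.prems by simp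
  moreover have "real (steps (for_each xs f (val (f x s)))) \<le> (\<Sum>x\<leftarrow>xs. c x + 1)"
    using Cons.prems by (intro Cons.IH) simp
  ultimately show ?case by simp
qed simp

lemma steps_tm_map_const:
  assumes "\<And>x. steps (f x) = c"
  shows "steps (tm_map f xs) = (c + 2) * length xs"
  using assms by (induction xs) auto

section \<open>Pointwise effect of repeated writes into arrays and matrix rows\<close>

lemma length_fold_list_update: "length (fold (\<lambda>k x. x[k := g k]) F x) = length x"
  by (induction F arbitrary: x) auto

lemma nth_fold_list_update:
  "k < length x \<Longrightarrow> fold (\<lambda>k x. x[k := g k]) F x ! k = (if k \<in> set F then g k else x ! k)"
  by (induction F arbitrary: x) (auto simp: nth_list_update)

lemma fold_update_mat_carrier:
  "M \<in> carrier_mat n m \<Longrightarrow> fold (\<lambda>k M. M |\<^sub>m (i, k) \<mapsto> g k) ks M \<in> carrier_mat n m"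
  by (induction ks arbitrary: M) (auto simp: update_mat_def)

lemma index_fold_update_mat:
  assumes "M \<in> carrier_mat n m" "p < n" "q < m"
  shows "fold (\<lambda>k M. M |\<^sub>m (i, k) \<mapsto> g k) ks M $$ (p, q) =
    (if p = i \<and> q \<in> set ks then g q else M $$ (p, q))"
  using assms
proof (induction ks arbitrary: M)
  case (Cons k ks)
  have "M |\<^sub>m (i, k) \<mapsto> g k \<in> carrier_mat n m"
    using Cons.prems by (auto simp: update_mat_def)
  then have "fold (\<lambda>k M. M |\<^sub>m (i, k) \<mapsto> g k) ks (M |\<^sub>m (i, k) \<mapsto> g k) $$ (p, q) =
      (if p = i \<and> q \<in> set ks then g q else (M |\<^sub>m (i, k) \<mapsto> g k) $$ (p, q))"
    using Cons.prems by (intro Cons.IH)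
  then show ?case using Cons.prems by (auto simp: update_mat_def)
qed simp


section \<open>The selection phase\<close>

lemma val_Q_inv_mult:
  "val (Q_inv_mult v) = map (\<lambda>a. (a - sum_list v / (1 + real (length v))) / 2) v"
  by (simp add: Q_inv_mult_def)

text \<open>The hypotheses on \<open>F\<close>, \<open>I\<close>, \<open>j\<close> and
  \<open>S\<close> form the loop invariant: \<open>F\<close> holds the largest entries so far, all
  of them at least \<open>r F\<close>. The exit test is, after rearrangement, a comparison of the
  next entry with \<open>r F\<close>, so on exit the same threshold bounds all remaining entries
  from above.\<close>

lemma select_correct:
  fixes b :: "real list"
  defines "r \<equiv> \<lambda>F. (\<Sum>k\<leftarrow>F. b ! k) / (1 + real (length F))"
  assumes "distinct (I @ F)" "sorted_wrt (\<ge>) (map (\<lambda>k. b ! k) I)"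
    and "\<And>k l. k \<in> set F \<Longrightarrow> l \<in> set I \<Longrightarrow> b ! l \<le> b ! k"
    and "\<And>k. k \<in> set F \<Longrightarrow> r F \<le> b ! k"
    and "j = length F + 1" "S = (\<Sum>k\<leftarrow>F. b ! k)"
    and "R = val (select b I j S F)"
  shows "distinct R \<and> set R \<subseteq> set I \<union> set F \<and> (\<forall>k\<in>set R. r R \<le> b ! k) \<and>
    (\<forall>k\<in>set I \<union> set F - set R. b ! k \<le> r R)"
  using assms(2-)
proof (induction I arbitrary: j S F)
  case Nil
  then show ?case by auto
next
  case (Cons k I)
  show ?case
  proof (cases "b ! k < (S + b ! k) / real (j + 1)")
    case True
    then have R: "R = F" using Cons.prems by simp
    \<comment> \<open>Here \<open>j + 1 = length F + 2\<close>, the denominator of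
      \<open>r (k # F)\<close>. Cancelling one \<open>b ! k\<close> on both sides leaves
      \<open>b ! k * (1 + real (length F)) < S\<close>, that is \<open>b ! k < r F\<close>.\<close>
    have "b ! k * (2 + real (length F)) < S + b ! k"
      using True Cons.prems(5) by (simp add: field_simps)
    then have "b ! k \<le> r F"
      using Cons.prems(6) by (simp add: r_def field_simps)
    moreover have "b ! l \<le> b ! k" if "l \<in> set I" for l using Cons.prems(2) that by auto
    ultimately show ?thesis using Cons.prems R by (fastforce intro: order_trans)
  next
    case False
    \<comment> \<open>The failed exit test is the invariant for the new element; the older elements
      of \<open>F\<close> inherit it because they are at least \<open>b ! k\<close>.\<close>
    have rk: "r (k # F) \<le> b ! k"
      using False Cons.prems(5,6) by (simp add: r_def add_ac)
    have "distinct R \<and> set R \<subseteq> set I \<union> set (k # F) \<and> (\<forall>k\<in>set R. r R \<le> b ! k) \<and>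
      (\<forall>l\<in>set I \<union> set (k # F) - set R. b ! l \<le> r R)"
    proof (rule Cons.IH)
      show "distinct (I @ k # F)" using Cons.prems(1) by auto
      show "b ! m \<le> b ! l" if "l \<in> set (k # F)" "m \<in> set I" for l m
        using that Cons.prems(2,3) by auto
      show "r (k # F) \<le> b ! l" if "l \<in> set (k # F)" for l
        using that rk Cons.prems(3)[of l k] by auto
      show "R = val (select b I (j + 1) (S + b ! k) (k # F))"
        using False Cons.prems by simp
    qed (use Cons.prems in auto)
    then show ?thesis by auto
  qed
qed

lemma length_select: "length (val (select b I j S F)) \<le> length I + length F"
proof (induction I arbitrary: j S F)
  case (Cons k I)
  then show ?case using Cons.IH[of "j + 1" "S + b ! k" "k # F"] by simp
qed simp

lemma steps_select: "steps (select b I j S F) \<le> 6 * length I"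
proof (induction I arbitrary: j S F)
  case (Cons k I)
  then show ?case using Cons.IH[of "j + 1" "S + b ! k" "k # F"] by simp
qed simp


section \<open>A single row\<close>

text \<open>Sorting, selection and \<open>Q_inv\<close> are summarized by one number
  \<open>t\<close>; the optimality argument uses only these two equations.\<close>

lemma row_solve_correct:
  assumes "sorting_routine srt"
  obtains t where
    "val (row_solve srt A i ns) = map (\<lambda>k. - max 0 (A $$ (i, i) - A $$ (i, k) - t)) ns"
    "sum_list (val (row_solve srt A i ns)) = - t"
proof -
  define b where "b = map (\<lambda>k. 2 * A $$ (i, i) - 2 * A $$ (i, k)) ns"
  define I where "I = val (srt b)"
  define F where "F = val (select b I (Suc 0) 0 [])"
  define r where "r = (\<Sum>k\<leftarrow>F. b ! k) / (1 + real (length F))"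
  define x where "x = val (row_solve srt A i ns)"
  have len: "length b = length ns" by (simp add: b_def)
  have "sorting_order b I" using assms by (simp add: sorting_routine_def I_def)
  then have I: "distinct I" "set I = {..<length b}" "sorted_wrt (\<ge>) (map (\<lambda>k. b ! k) I)"
    by (simp_all add: sorting_order_def)
  have F: "distinct F" "set F \<subseteq> {..<length b}" "\<And>k. k \<in> set F \<Longrightarrow> r \<le> b ! k"
    "\<And>k. k < length b \<Longrightarrow> k \<notin> set F \<Longrightarrow> b ! k \<le> r"
    using select_correct[of I "[]" b "Suc 0" 0 F] I by (auto simp: F_def r_def)
  \<comment> \<open>Turns the loop over index-value pairs into a fold over \<open>F\<close> alone,
    to which \<open>nth_fold_list_update\<close> applies.\<close>
  have zip: "zip F (map h F) = map (\<lambda>k. (k, h k)) F" for h :: "nat \<Rightarrow> real"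
    by (induction F) auto
  have xfold: "x = fold (\<lambda>k x. x[k := - ((b ! k - r) / 2)]) F (replicate (length ns) 0)"
    unfolding x_def row_solve_def
    by (simp add: val_for_each val_Q_inv_mult o_def zip fold_map r_def
        flip: b_def I_def F_def)
  have lenx: "length x = length ns" by (simp add: xfold length_fold_list_update)
  have xk: "x ! k = - (if k \<in> set F then (b ! k - r) / 2 else 0)" if "k < length ns" for k
    using that by (simp add: xfold nth_fold_list_update)
  have "x = map (\<lambda>k. - max 0 (A $$ (i, i) - A $$ (i, k) - r / 2)) ns"
  proof (rule nth_equalityI)
    fix k assume "k < length x"
    then have k: "k < length ns" by (simp add: lenx)
    have "b ! k = 2 * A $$ (i, i) - 2 * A $$ (i, ns ! k)" using k by (simp add: b_def)
    \<comment> \<open>The threshold property makes membership in \<open>F\<close> agree with the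
      sign of \<open>b ! k - r\<close>; at equality both alternatives give 0, so ties are
      harmless.\<close>
    then show "x ! k = map (\<lambda>k. - max 0 (A $$ (i, i) - A $$ (i, k) - r / 2)) ns ! k"
      using F(3)[of k] F(4)[of k] k len by (auto simp: xk max_def field_simps)
  qed (simp add: lenx)
  moreover have "sum_list x = - (r / 2)"
  proof -
    have "sum_list x = (\<Sum>k<length ns. - (if k \<in> set F then (b ! k - r) / 2 else 0))"
      by (simp add: sum_list_sum_nth lenx atLeast0LessThan xk)
    also have "\<dots> = - (\<Sum>k\<in>set F. (b ! k - r) / 2)"
      using F(2) len by (simp add: sum_negf sum.If_cases Int_absorb1 Int_def[symmetric])
    also have "\<dots> = - (((\<Sum>k\<in>set F. b ! k) - real (length F) * r) / 2)"
      using distinct_card[OF F(1)] by (simp add: sum_subtractf flip: sum_divide_distrib)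
    also have "(\<Sum>k\<in>set F. b ! k) = (\<Sum>k\<leftarrow>F. b ! k)"
      using F(1) by (simp add: sum_list_distinct_conv_sum_set)
    \<comment> \<open>The extra 1 in the denominator of \<open>r\<close> matters here: subtracting
      \<open>real (length F) * r\<close> leaves exactly \<open>r\<close>.\<close>
    also have "\<dots> = (1 + real (length F)) * r"
      by (simp add: r_def)
    finally show ?thesis by (simp add: algebra_simps)
  qed
  ultimately show ?thesis using that[of "r / 2"] by (simp add: x_def)
qed

text \<open>The sorting cost is left as the cost on some list of the right length, since the bound
  on the routine depends on the length only.\<close>

lemma steps_row_solve:
  assumes "sorting_routine srt"
  shows "\<exists>b. length b = length ns \<and>
    steps (row_solve srt A i ns) \<le> steps (srt b) + 26 * length ns + 4"
proof -
  define b where "b = map (\<lambda>k. 2 * A $$ (i, i) - 2 * A $$ (i, k)) ns"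
  define I where "I = val (srt b)"
  define F where "F = val (select b I (Suc 0) 0 [])"
  have "sorting_order b I" using assms by (simp add: sorting_routine_def I_def)
  then have I: "length I = length ns"
    by (metis b_def card_lessThan distinct_card length_map sorting_order_def)
  \<comment> \<open>Per neighbor, 8 is 1 for initializing \<open>x\<close> and 7 for
    \<open>b\<close>; per element of \<open>F\<close>, 12 is 3 for \<open>bF\<close>, 6 for
    \<open>Q_inv_mult\<close> and 3 for writing back. The 4 is 1 for the length of \<open>ns\<close>
    and 3 from \<open>Q_inv_mult\<close>.\<close>
  have "steps (row_solve srt A i ns) = steps (srt b) + steps (select b I (Suc 0) 0 [])
      + 8 * length ns + 12 * length F + 4"
    unfolding row_solve_def
    by (simp add: steps_tm_map_const[of _ 5] steps_tm_map_const[of _ 1] steps_Q_inv_mult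
        steps_for_each_const[of _ 2] val_Q_inv_mult split_beta flip: b_def I_def F_def)
  moreover have "length F \<le> length ns" using length_select[of b I "Suc 0" 0 "[]"] I by (simp add: F_def)
  moreover have "steps (select b I (Suc 0) 0 []) \<le> 6 * length ns"
    using steps_select[of b I "Suc 0" 0 "[]"] I by simp
  ultimately show ?thesis by (intro exI[of _ b]) (auto simp: b_def)
qed

lemma steps_row_step:
  assumes "sorting_routine srt"
  shows "\<exists>b. length b = length ns \<and>
    steps (row_step srt A i ns L) \<le> steps (srt b) + 30 * length ns + 6"
proof -
  obtain t where "val (row_solve srt A i ns) =
      map (\<lambda>k. - max 0 (A $$ (i, i) - A $$ (i, k) - t)) ns"
    using row_solve_correct[OF assms] .
  then have "length (val (row_solve srt A i ns)) = length ns" by simp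
  then have "steps (row_step srt A i ns L) = steps (row_solve srt A i ns) + 4 * length ns + 2"
    unfolding row_step_def by (simp add: steps_for_each_const[of _ 1] split_beta)
  with steps_row_solve[OF assms, of ns A i] show ?thesis by fastforce
qed

text \<open>The KKT solution of row \<open>i\<close> over the neighbor set \<open>K\<close>, with
  diagonal entry \<open>t\<close>. The first conjunct is the zero row sum, written as a fixed-point
  equation that also forces \<open>t\<close> to be nonnegative.\<close>

definition optimal_row :: "real mat \<Rightarrow> nat set \<Rightarrow> real mat \<Rightarrow> nat \<Rightarrow> real \<Rightarrow> bool" where
  "optimal_row A K M i t \<longleftrightarrow> t = (\<Sum>k\<in>K. max 0 (A $$ (i, i) - A $$ (i, k) - t)) \<and>
     (\<forall>j<dim_col M. M $$ (i, j) =
       (if j = i then t else if j \<in> K then - max 0 (A $$ (i, i) - A $$ (i, j) - t) else 0))"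

text \<open>Positions outside \<open>ns\<close> and the diagonal are never written, so their zeros
  come from \<open>L0\<close>. The second claim preserves the rows finished earlier.\<close>

lemma row_step_correct:
  fixes srt A i ns L
  defines "M \<equiv> val (row_step srt A i ns L)"
  assumes srt: "sorting_routine srt" and L: "L \<in> carrier_mat n n" and i: "i < n"
    and ns: "distinct ns" "i \<notin> set ns" and L0: "\<And>j. j < n \<Longrightarrow> L $$ (i, j) = 0"
  shows "M \<in> carrier_mat n n"
    and "\<And>p q. p < n \<Longrightarrow> q < n \<Longrightarrow> p \<noteq> i \<Longrightarrow> M $$ (p, q) = L $$ (p, q)"
    and "\<exists>t. optimal_row A (set ns) M i t"
proof -
  define x where "x = val (row_solve srt A i ns)"
  obtain t where x: "x = map (\<lambda>k. - max 0 (A $$ (i, i) - A $$ (i, k) - t)) ns"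
    and sumx: "sum_list x = - t"
    using row_solve_correct[OF srt, of A i ns] unfolding x_def by metis
  define M' where
    "M' = fold (\<lambda>k M. M |\<^sub>m (i, k) \<mapsto> - max 0 (A $$ (i, i) - A $$ (i, k) - t)) ns L"
  have zip: "zip ns (map h ns) = map (\<lambda>k. (k, h k)) ns" for h :: "nat \<Rightarrow> real"
    by (induction ns) auto
  have M: "M = M' |\<^sub>m (i, i) \<mapsto> t"
    using sumx unfolding M_def row_step_def M'_def
    by (simp add: val_for_each split_beta zip fold_map o_def x flip: x_def)
  have M': "M' \<in> carrier_mat n n" unfolding M'_def using L by (rule fold_update_mat_carrier)
  then show Mc: "M \<in> carrier_mat n n" by (auto simp: M update_mat_def)
  have idx: "M $$ (p, q) = (if p = i \<and> q = i then t
      else if p = i \<and> q \<in> set ns then - max 0 (A $$ (i, i) - A $$ (i, q) - t) else L $$ (p, q))"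
    if "p < n" "q < n" for p q
    using that M' index_fold_update_mat[OF L that] by (auto simp: M update_mat_def M'_def)
  then show "\<And>p q. p < n \<Longrightarrow> q < n \<Longrightarrow> p \<noteq> i \<Longrightarrow> M $$ (p, q) = L $$ (p, q)" by auto
  have "t = (\<Sum>k\<in>set ns. max 0 (A $$ (i, i) - A $$ (i, k) - t))"
    using sumx ns(1) by (simp add: x sum_list_distinct_conv_sum_set sum_negf)
  then show "\<exists>t. optimal_row A (set ns) M i t"
    using Mc idx[OF i] L0 by (auto simp: optimal_row_def)
qed


section \<open>Optimality\<close>

lemma optimal_row_cong:
  assumes "\<And>j. j < dim_col M \<Longrightarrow> M' $$ (i, j) = M $$ (i, j)" "dim_col M' = dim_col M"
  shows "optimal_row A K M' i t \<longleftrightarrow> optimal_row A K M i t"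
  using assms by (simp add: optimal_row_def)

lemma rowwise_sorting_correct:
  fixes srt n A N
  defines "M \<equiv> val (rowwise_sorting srt n A N)"
  assumes srt: "sorting_routine srt" and N: "\<And>i. i < n \<Longrightarrow> distinct (N i) \<and> i \<notin> set (N i)"
  shows "M \<in> carrier_mat n n" and "\<And>i. i < n \<Longrightarrow> \<exists>t. optimal_row A (set (N i)) M i t"
proof -
  define step where "step = (\<lambda>i L. val (row_step srt A i (N i) L))"
  define R where "R = (\<lambda>m. fold step [0..<m] (0\<^sub>m n n))"
  \<comment> \<open>Invariant of the outer loop: the first \<open>m\<close> rows are optimal and the
    later ones are still zero, which supplies \<open>L0\<close> for the next step.\<close>
  have "R m \<in> carrier_mat n n \<and> (\<forall>i<m. \<exists>t. optimal_row A (set (N i)) (R m) i t) \<and>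
      (\<forall>i<n. \<forall>j<n. m \<le> i \<longrightarrow> R m $$ (i, j) = 0)" if "m \<le> n" for m
    using that
  proof (induction m)
    case 0
    then show ?case by (simp add: R_def)
  next
    case (Suc m)
    then have IH: "R m \<in> carrier_mat n n" "\<And>i. i < m \<Longrightarrow> \<exists>t. optimal_row A (set (N i)) (R m) i t"
      "\<And>i j. i < n \<Longrightarrow> j < n \<Longrightarrow> m \<le> i \<Longrightarrow> R m $$ (i, j) = 0" and m: "m < n"
      by auto
    have RS: "R (Suc m) = val (row_step srt A m (N m) (R m))" by (simp add: R_def step_def)
    have c: "R (Suc m) \<in> carrier_mat n n"
      and old: "\<And>p q. p < n \<Longrightarrow> q < n \<Longrightarrow> p \<noteq> m \<Longrightarrow> R (Suc m) $$ (p, q) = R m $$ (p, q)"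
      and new: "\<exists>t. optimal_row A (set (N m)) (R (Suc m)) m t"
      using row_step_correct[OF srt IH(1) m, where ns = "N m" and A = A] N[OF m] IH(3)[OF m] unfolding RS by auto
    have "\<exists>t. optimal_row A (set (N i)) (R (Suc m)) i t" if "i < Suc m" for i
    proof (cases "i = m")
      case False
      with that m have "i < m" "i < n" by auto
      then show ?thesis
        using IH(2) optimal_row_cong[of "R m" "R (Suc m)" i A "set (N i)"] old[of i] IH(1) c False
        by auto
    qed (use new in simp)
    then show ?case using c old IH(3) by auto
  qed
  from this[of n] show "M \<in> carrier_mat n n"
    and "\<And>i. i < n \<Longrightarrow> \<exists>t. optimal_row A (set (N i)) M i t"
    by (simp_all add: M_def rowwise_sorting_def val_for_each R_def step_def)
qed

section \<open>Feasibility and minimality, first for one row and then for the matrix\<close>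

lemma mat_mult_ones_eq_0_iff:
  fixes L :: "real mat"
  assumes "L \<in> carrier_mat n n"
  shows "L *\<^sub>v vec n (\<lambda>_. 1) = 0\<^sub>v n \<longleftrightarrow> (\<forall>i<n. (\<Sum>j<n. L $$ (i, j)) = 0)"
  using assms by (auto simp: vec_eq_iff scalar_prod_def atLeast0LessThan)

lemma optimal_row_sum_eq_0:
  assumes "optimal_row A K M i t" "dim_col M = n" "i < n" "i \<notin> K" "K \<subseteq> {..<n}"
  shows "(\<Sum>j<n. M $$ (i, j)) = 0"
proof -
  let ?u = "\<lambda>k. max 0 (A $$ (i, i) - A $$ (i, k) - t)"
  have "(\<Sum>j<n. M $$ (i, j)) = (\<Sum>j<n. (if j = i then t else 0) - (if j \<in> K then ?u j else 0))"
    using assms by (intro sum.cong) (auto simp: optimal_row_def)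
  also have "\<dots> = t - (\<Sum>j\<in>K. ?u j)"
    using assms by (simp add: sum_subtractf sum.If_cases Int_absorb1 Int_def[symmetric])
  finally show ?thesis using assms(1) by (simp add: optimal_row_def)
qed

text \<open>A variational inequality at the row \<open>m\<close> of \<open>M\<close>, with
  \<open>t - a i\<close> as multiplier of the row-sum constraint, combined with the exact quadratic
  expansion of the objective around \<open>m\<close>.\<close>

lemma optimal_row_minimal:
  fixes l :: "nat \<Rightarrow> real"
  assumes opt: "optimal_row A K M i t" and dim: "dim_col M = n" and i: "i < n"
    and K: "i \<notin> K" "K \<subseteq> {..<n}"
    and l: "(\<Sum>j<n. l j) = 0" "\<And>j. j \<in> K \<Longrightarrow> l j \<le> 0"
      "\<And>j. j < n \<Longrightarrow> j \<noteq> i \<Longrightarrow> j \<notin> K \<Longrightarrow> l j = 0"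
  shows "(\<Sum>j<n. (A $$ (i, j) - M $$ (i, j))\<^sup>2) \<le> (\<Sum>j<n. (A $$ (i, j) - l j)\<^sup>2)"
proof -
  define m a where "m = (\<lambda>j. M $$ (i, j))" and "a = (\<lambda>j. A $$ (i, j))"
  have m: "m j = (if j = i then t else if j \<in> K then - max 0 (a i - a j - t) else 0)" if "j < n" for j
    using opt dim that by (simp add: optimal_row_def m_def a_def)
  have msum: "(\<Sum>j<n. m j) = 0" unfolding m_def using optimal_row_sum_eq_0[OF opt dim i K] .
  \<comment> \<open>The first factor, half the derivative minus the multiplier, vanishes at
    \<open>j = i\<close> and wherever the maximum is attained by its second argument. At the other
    neighbors \<open>m j = 0\<close> and both factors are nonpositive; off \<open>K\<close> and the
    diagonal the second factor is 0.\<close>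
  have "0 \<le> (m j - a j - (t - a i)) * (l j - m j)" if j: "j < n" for j
  proof -
    consider "j = i" | "j \<in> K" "j \<noteq> i" | "j \<notin> K" "j \<noteq> i" by blast
    then show ?thesis
    proof cases
      case 2
      then have mj: "m j = - max 0 (a i - a j - t)" using m[OF j] by simp
      show ?thesis
      proof (cases "0 \<le> a i - a j - t")
        case False
        then have "m j = 0" using mj by simp
        then show ?thesis using False l(2)[OF 2(1)] by (auto intro!: mult_nonpos_nonpos)
      qed (simp add: mj)
    qed (use m[OF j] l(3)[OF j] in auto)
  qed
  then have "0 \<le> (\<Sum>j<n. (m j - a j - (t - a i)) * (l j - m j))" by (intro sum_nonneg) auto
  also have "\<dots> = (\<Sum>j<n. (m j - a j) * (l j - m j) - (t - a i) * (l j - m j))"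
    by (simp add: left_diff_distrib)
  \<comment> \<open>The multiplier drops out because \<open>l\<close> and \<open>m\<close> both sum
    to 0.\<close>
  also have "\<dots> = (\<Sum>j<n. (m j - a j) * (l j - m j))"
    using l(1) msum by (simp add: sum_subtractf flip: sum_distrib_left)
  finally have "0 \<le> 2 * (\<Sum>j<n. (m j - a j) * (l j - m j)) + (\<Sum>j<n. (l j - m j)\<^sup>2)"
    by (simp add: sum_nonneg)
  also have "\<dots> = (\<Sum>j<n. (a j - l j)\<^sup>2) - (\<Sum>j<n. (a j - m j)\<^sup>2)"
    unfolding sum_distrib_left sum.distrib[symmetric] sum_subtractf[symmetric]
    by (intro sum.cong) (auto simp: power2_eq_square algebra_simps)
  finally show ?thesis by (simp add: m_def a_def)
qed

lemma frobenius_norm_diff_square: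
  assumes "A \<in> carrier_mat n n" "L \<in> carrier_mat n n"
  shows "(frobenius_norm (A - L))\<^sup>2 = (\<Sum>i<n. \<Sum>j<n. (A $$ (i, j) - L $$ (i, j))\<^sup>2)"
  using assms by (simp add: frobenius_norm_def sum_nonneg)

text \<open>Both the constraints and the squared Frobenius norm decouple over the rows, so
  minimality of each row adds up to minimality of the matrix.\<close>

lemma rowwise_sorting_is_arg_min:
  assumes srt: "sorting_routine srt" and A: "A \<in> carrier_mat n n"
    and N: "\<And>i. i < n \<Longrightarrow> distinct (N i) \<and> set (N i) = nbrs n E i"
  shows "is_arg_min (\<lambda>L. (frobenius_norm (A - L))\<^sup>2) (\<lambda>L. L \<in> L_sd n E)
    (val (rowwise_sorting srt n A N))"
proof -
  define M where "M = val (rowwise_sorting srt n A N)"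
  have K: "i \<notin> nbrs n E i" "nbrs n E i \<subseteq> {..<n}" for i by (auto simp: nbrs_def)
  have M: "M \<in> carrier_mat n n"
    and opt: "\<And>i. i < n \<Longrightarrow> \<exists>t. optimal_row A (nbrs n E i) M i t"
    using rowwise_sorting_correct[OF srt, where n = n and N = N and A = A] N K(1) unfolding M_def by auto
  have dim: "dim_col M = n" using M by simp
  have "0 \<le> M $$ (i, i)"
    and "\<forall>j<n. i \<noteq> j \<longrightarrow> (i, j) \<in> E \<longrightarrow> M $$ (i, j) \<le> 0"
    and "\<forall>j<n. i \<noteq> j \<longrightarrow> (i, j) \<notin> E \<longrightarrow> M $$ (i, j) = 0"
    and "(\<Sum>j<n. M $$ (i, j)) = 0" if i: "i < n" for i
  proof -
    obtain t where t: "optimal_row A (nbrs n E i) M i t" using opt[OF i] by blast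
    then have "0 \<le> t" unfolding optimal_row_def by (metis (lifting) max.cobounded1 sum_nonneg)
    then show "0 \<le> M $$ (i, i)"
      and "\<forall>j<n. i \<noteq> j \<longrightarrow> (i, j) \<in> E \<longrightarrow> M $$ (i, j) \<le> 0"
      and "\<forall>j<n. i \<noteq> j \<longrightarrow> (i, j) \<notin> E \<longrightarrow> M $$ (i, j) = 0"
      using t dim i by (auto simp: optimal_row_def nbrs_def)
    show "(\<Sum>j<n. M $$ (i, j)) = 0" using optimal_row_sum_eq_0[OF t dim i K] .
  qed
  then have "M \<in> L_sd n E" using M by (simp add: L_sd_def mat_mult_ones_eq_0_iff)
  moreover have "(frobenius_norm (A - M))\<^sup>2 \<le> (frobenius_norm (A - L))\<^sup>2" if L: "L \<in> L_sd n E" for L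
  proof -
    have Lc: "L \<in> carrier_mat n n" using L by (simp add: L_sd_def)
    have "(\<Sum>j<n. (A $$ (i, j) - M $$ (i, j))\<^sup>2) \<le> (\<Sum>j<n. (A $$ (i, j) - L $$ (i, j))\<^sup>2)"
      if i: "i < n" for i
    proof -
      obtain t where "optimal_row A (nbrs n E i) M i t" using opt[OF i] by blast
      then show ?thesis using dim i K
        by (rule optimal_row_minimal)
          (use L Lc i in \<open>auto simp: L_sd_def mat_mult_ones_eq_0_iff nbrs_def\<close>)
    qed
    then show ?thesis
      unfolding frobenius_norm_diff_square[OF A M] frobenius_norm_diff_square[OF A Lc]
      by (rule sum_mono) simp
  qed
  ultimately show ?thesis by (auto simp: is_arg_min_def not_less M_def)
qed


section \<open>Running time\<close>

lemma steps_rowwise_sorting: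
  assumes "sorting_routine srt"
  obtains C :: real where "\<And>n A N. real (steps (rowwise_sorting srt n A N))
    \<le> C * (\<Sum>i<n. if length (N i) \<le> 1 then 1 else real (length (N i)) * log 2 (length (N i)))"
proof -
  obtain c where c: "\<And>b. real (steps (srt b)) \<le> c * max 1 (real (length b) * log 2 (length b))"
    using assms by (auto simp: sorting_routine_def)
  \<comment> \<open>The cost measure of one row: it equals \<open>max 1 (d log d)\<close> and
    dominates both \<open>d\<close> and 1, so linear and constant costs are absorbed into
    it.\<close>
  define w where "w = (\<lambda>d::nat. if d \<le> 1 then 1 else real d * log 2 d)"
  have w: "max 1 (real d * log 2 d) = w d" "real d \<le> w d" "1 \<le> w d" for d
  proof -
    have "max 1 (real d * log 2 d) = w d \<and> real d \<le> w d \<and> 1 \<le> w d"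
    proof (cases "d \<le> 1")
      case True
      then consider "d = 0" | "d = 1" by linarith
      then show ?thesis by cases (simp_all add: w_def)
    next
      case False
      then have *: "real d * 1 \<le> real d * log 2 d" by (intro mult_left_mono) (auto simp: le_log_iff)
      have "1 \<le> real d" using False by simp
      with * have "1 \<le> real d * log 2 d" by linarith
      with False * show ?thesis by (simp add: w_def)
    qed
    then show "max 1 (real d * log 2 d) = w d" "real d \<le> w d" "1 \<le> w d" by auto
  qed
  have row: "real (steps (row_step srt A i ns L)) \<le> (c + 36) * w (length ns)" for A i ns L
  proof -
    obtain b where b: "length b = length ns"
      "steps (row_step srt A i ns L) \<le> steps (srt b) + 30 * length ns + 6"
      using steps_row_step[OF assms, of ns A i L] by blast
    have "real (steps (row_step srt A i ns L)) \<le> real (steps (srt b)) + 30 * real (length ns) + 6"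
      using b(2) by linarith
    also have "\<dots> \<le> c * w (length ns) + 30 * w (length ns) + 6 * w (length ns)"
      using c[of b] w[of "length ns"] by (auto simp: b(1) intro!: add_mono)
    finally show ?thesis by (simp add: algebra_simps)
  qed
  \<comment> \<open>The row bound contributes 36 = 30 + 6; the remaining 2 are the reading of
    \<open>N i\<close> and the pass through the outer loop.\<close>
  have "real (steps (rowwise_sorting srt n A N)) \<le> (c + 38) * (\<Sum>i<n. w (length (N i)))" for n A N
  proof -
    have "real (steps (rowwise_sorting srt n A N)) \<le>
        (\<Sum>i\<leftarrow>[0..<n]. ((c + 36) * w (length (N i)) + 1) + 1)"
      unfolding rowwise_sorting_def using row by (intro steps_for_each_le) simp
    also have "\<dots> \<le> (\<Sum>i<n. (c + 38) * w (length (N i)))"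
      unfolding interv_sum_list_conv_sum_set_nat set_upt atLeast0LessThan
    proof (intro sum_mono)
      fix i
      show "((c + 36) * w (length (N i)) + 1) + 1 \<le> (c + 38) * w (length (N i))"
        using w(3)[of "length (N i)"] by (simp add: algebra_simps)
    qed
    finally show ?thesis by (simp add: sum_distrib_left)
  qed
  then show ?thesis using that[of "c + 38"] unfolding w_def by blast
qed

text \<open>\<open>C\<close> is chosen before the graph and the matrix, hence uniform in both. The
  counting term pays for rows of degree at most 1, which cost constant time although
  \<open>d log d\<close> vanishes there. \<open>sorting_routine_merge_sort\<close> provides an
  instance of the assumption.\<close>

theorem corollary3p13:
  fixes srt :: "real list \<Rightarrow> nat list tm"
  assumes "sorting_routine srt"
  shows "\<exists>C::real. \<forall>(n::nat) (E::(nat \<times> nat) set) (A::real mat) (N::nat \<Rightarrow> nat list) (d::nat \<Rightarrow> nat).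
    simple_digraph n E \<and> A \<in> carrier_mat n n \<and>
    (\<forall>i<n. distinct (N i) \<and> set (N i) = nbrs n E i) \<and>
    (\<forall>i<n. d i = card (nbrs n E i)) \<longrightarrow>
      is_arg_min (\<lambda>L. (frobenius_norm (A - L))\<^sup>2) (\<lambda>L. L \<in> L_sd n E)
        (val (rowwise_sorting srt n A N)) \<and>
      real (steps (rowwise_sorting srt n A N))
        \<le> C * ((\<Sum>i<n. real (d i) * log 2 (real (d i))) + real (card {i. i < n \<and> d i \<le> 1}))"
proof -
  obtain C :: real where C: "\<And>n A N. real (steps (rowwise_sorting srt n A N))
    \<le> C * (\<Sum>i<n. if length (N i) \<le> 1 then 1 else real (length (N i)) * log 2 (length (N i)))"
    using steps_rowwise_sorting[OF assms] by blast
  show ?thesis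
  proof (intro exI[of _ C] allI impI conjI)
    fix n E and A :: "real mat" and N :: "nat \<Rightarrow> nat list" and d :: "nat \<Rightarrow> nat"
    assume *: "simple_digraph n E \<and> A \<in> carrier_mat n n \<and>
      (\<forall>i<n. distinct (N i) \<and> set (N i) = nbrs n E i) \<and> (\<forall>i<n. d i = card (nbrs n E i))"
    show "is_arg_min (\<lambda>L. (frobenius_norm (A - L))\<^sup>2) (\<lambda>L. L \<in> L_sd n E)
        (val (rowwise_sorting srt n A N))"
      using * by (intro rowwise_sorting_is_arg_min[OF assms]) auto
    have len: "length (N i) = d i" if "i < n" for i
      using * that by (metis distinct_card)
    have "(\<Sum>i<n. if length (N i) \<le> 1 then 1 else real (length (N i)) * log 2 (length (N i))) =
        (\<Sum>i<n. real (d i) * log 2 (d i) + (if d i \<le> 1 then 1 else 0))"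
    proof (intro sum.cong)
      fix i assume "i \<in> {..<n}"
      \<comment> \<open>For degree 0 the factor \<open>real (d i)\<close> is 0, for degree 1 the
        logarithm is; hence the case distinction becomes a sum of two terms.\<close>
      moreover have "real (d i) * log 2 (d i) = 0" if "d i \<le> 1"
        using that by (cases "d i") auto
      ultimately show "(if length (N i) \<le> 1 then 1
          else real (length (N i)) * log 2 (length (N i))) =
          real (d i) * log 2 (d i) + (if d i \<le> 1 then 1 else 0)"
        using len by simp
    qed simp
    also have "\<dots> = (\<Sum>i<n. real (d i) * log 2 (d i)) + real (card {i. i < n \<and> d i \<le> 1})"
      by (simp add: sum.distrib sum.If_cases Int_def)
    finally show "real (steps (rowwise_sorting srt n A N))
        \<le> C * ((\<Sum>i<n. real (d i) * log 2 (real (d i))) + real (card {i. i < n \<and> d i \<le> 1}))"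
      using C[of n A N] by simp
  qed
qed

end
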